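(* For every $c_0 > 0$ and $\delta > 0$ there exists $C = C(\delta, c_0) > 0$ such that the following holds. Let $k, \ell \in \mathbb{N}$ with $\ell^3 \geqslant Ck$, and let $c \geqslant c_0$. Then the number of sets $S \subset \mathbb{N}$ with $|S| = \ell$, $\sum_{a \in S} a = k$ and $|S + S| \leqslant ck/\ell$ is at most $$2^{\delta \ell} \left( \frac{2cek}{3\ell^2} \right)^{\ell}.$$
   Context: $\mathbb{N} = \{1,2,3,\ldots\}$. For $A, B \subset \mathbb{N}$, the sumset is $A + B = \{a + b : a \in A, b \in B\}$. *)

theory Defs
  imports Complex_Main
begin

definition sumset :: "nat set \<Rightarrow> nat set \<Rightarrow> nat set" where
  "sumset A B = {x. \<exists>a\<in>A. \<exists>b\<in>B. x = a + b}"

end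

theory Submission
  imports Defs
begin

text \<open>
  If \<open>c > 5\<close>, the bound already holds for the number of all \<open>l\<close>-sets of sum \<open>k\<close>. Otherwise fix a
  large constant \<open>K\<close> and put \<open>n = K k / l\<close>; all but \<open>l / K\<close> elements of \<open>S\<close> lie in \<open>{1..n}\<close>, and
  \<open>l\<close> is much larger than \<open>sqrt n\<close>. The part \<open>S \<inter> {1..n}\<close> is caught by a container. Keep sets
  \<open>A\<close> containing it and \<open>B\<close> contained in its sumset, initially \<open>{1..n}\<close> and \<open>{}\<close>. Suppose that it
  has about \<open>sqrt n\<close> elements \<open>x\<close> for which at least \<open>\<epsilon> n\<close> elements of \<open>x + A\<close> lie outside
  \<open>B\<close>, and collect them in \<open>T\<close>. Pick greedily \<open>U \<subseteq> S\<close> such that each element of \<open>U\<close> puts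
  a proportion of \<open>\<epsilon> / 4\<close> of its translate of \<open>T\<close> into \<open>B\<close> for the first time; the elements of
  \<open>A\<close> which could still prolong \<open>U\<close> are not in \<open>S\<close>. Adding \<open>T + U\<close> to \<open>B\<close> and deleting those
  elements from \<open>A\<close> decreases \<open>|A| - |B|\<close> by a constant proportion of \<open>n\<close>, so this stops after
  boundedly many rounds. Once nearly all of \<open>min A + A\<close> and \<open>max A + A\<close> lies in \<open>B\<close>, we have
  \<open>2 |A| \<le> |B| + O(\<epsilon> n)\<close>, hence \<open>|A|\<close> is barely more than \<open>c k / (2 l)\<close>.

  The container is determined by a fingerprint of \<open>O(sqrt n)\<close> elements of \<open>S\<close>. Fingerprint and
  large elements cost a factor \<open>exp (l / 10)\<close>, which is absorbed by the gap between \<open>1/2\<close> and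
  \<open>2/3\<close>.
\<close>

section \<open>Elementary facts on sumsets\<close>

lemma sumset_eq_UN: "sumset T U = (\<Union>u\<in>U. (+) u ` T)"
  unfolding sumset_def by (auto simp: image_iff) (metis add.commute)+

lemma sumset_mono: "A \<subseteq> A' \<Longrightarrow> B \<subseteq> B' \<Longrightarrow> sumset A B \<subseteq> sumset A' B'"
  unfolding sumset_def by blast

lemma finite_sumset [simp]: "finite A \<Longrightarrow> finite B \<Longrightarrow> finite (sumset A B)"
  by (simp add: sumset_eq_UN)

lemma card_le_card_sumset:
  assumes "finite A" "A \<noteq> {}"
  shows "card A \<le> card (sumset A A)"
proof -
  obtain a where "a \<in> A" using assms by blast
  have "card A = card ((+) a ` A)" by (simp add: card_image)
  also have "\<dots> \<le> card (sumset A A)"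
    using \<open>a \<in> A\<close> assms by (intro card_mono) (auto simp: sumset_eq_UN)
  finally show ?thesis .
qed

lemma card_sumset_le:
  assumes "S \<subseteq> {1..n}"
  shows "card (sumset S S) \<le> 2 * n"
proof -
  have "sumset S S \<subseteq> {1..2 * n}"
  proof
    fix x assume "x \<in> sumset S S"
    then obtain a b where "a \<in> S" "b \<in> S" "x = a + b" by (auto simp: sumset_def)
    moreover from this have "a \<in> {1..n}" "b \<in> {1..n}" using assms by blast+
    ultimately show "x \<in> {1..2 * n}" by simp
  qed
  then show ?thesis using card_mono[of "{1..2 * n}"] by simp
qed

section \<open>Greedy refinement of container and covered sums\<close>

lemma card_translate_diff: "card ((+) y ` T - B) = card {\<tau> \<in> T. y + \<tau> \<notin> B}" for y :: nat
proof -
  have "(+) y ` T - B = (+) y ` {\<tau> \<in> T. y + \<tau> \<notin> B}" by auto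
  then show ?thesis by (simp add: card_image)
qed

text \<open>Take \<open>U\<close> maximal under inclusion among the subsets of \<open>S\<close> that
  gain on average at least \<open>\<theta>\<close> new sums per element. An element of
  \<open>S\<close> violating the last claim could be inserted into \<open>U\<close>, as its
  translate of \<open>T\<close> adds at least \<open>\<theta>\<close> further sums.\<close>

lemma exists_saturating_subset:
  fixes \<theta> :: real
  assumes S: "finite S" and T: "finite T" and \<theta>: "\<theta> > 0"
  obtains U where "U \<subseteq> S" "\<theta> * card U \<le> card (sumset T U - B)"
    "\<forall>y\<in>S. card ((+) y ` T - (B \<union> sumset T U)) < \<theta>"
proof -
  define P where "P = {U \<in> Pow S. \<theta> * card U \<le> card (sumset T U - B)}"
  have "finite P" "{} \<in> P" using S by (auto simp: P_def)
  then obtain U where U: "U \<in> P" and max: "\<And>V. V \<in> P \<Longrightarrow> U \<subseteq> V \<Longrightarrow> U = V"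
    using finite_has_maximal[of P] by blast
  then have US: "U \<subseteq> S" and Uc: "\<theta> * card U \<le> card (sumset T U - B)" by (auto simp: P_def)
  have fU: "finite U" using US S finite_subset by blast
  have "card ((+) y ` T - (B \<union> sumset T U)) < \<theta>" if y: "y \<in> S" for y
  proof (rule ccontr)
    assume neg: "\<not> ?thesis"
    have yU: "y \<notin> U"
    proof
      assume "y \<in> U"
      then have "(+) y ` T - (B \<union> sumset T U) = {}" by (auto simp: sumset_eq_UN)
      then show False using neg \<theta> by (metis card.empty of_nat_0)
    qed
    have split: "sumset T (insert y U) - B =
        (sumset T U - B) \<union> ((+) y ` T - (B \<union> sumset T U))"
      by (auto simp: sumset_eq_UN)
    have "card (sumset T (insert y U) - B)
        = card (sumset T U - B) + card ((+) y ` T - (B \<union> sumset T U))"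
      unfolding split using T fU by (intro card_Un_disjoint) auto
    then have "\<theta> * card (insert y U) \<le> card (sumset T (insert y U) - B)"
      using neg Uc yU fU by (simp add: algebra_simps)
    then have "insert y U \<in> P" using US y by (simp add: P_def)
    then have "U = insert y U" using max by blast
    then show False using yU by blast
  qed
  with US Uc that show thesis by blast
qed

text \<open>A state \<open>(A, B)\<close> records that the set \<open>S\<close> under study satisfies \<open>S \<subseteq> A\<close> and
  \<open>B \<subseteq> S + S\<close>. Refining by \<open>T, U \<subseteq> S\<close> puts \<open>T + U\<close> into \<open>B\<close> and deletes from \<open>A\<close> the
  elements which \<open>U\<close> shows not to be in \<open>S\<close>.\<close>

definition refine :: "real \<Rightarrow> nat set \<times> nat set \<Rightarrow> nat set \<times> nat set \<Rightarrow> nat set \<times> nat set" where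
  "refine \<theta> p q = (let B' = snd p \<union> sumset (fst q) (snd q) in
     ({y \<in> fst p. real (card ((+) y ` fst q - B')) < \<theta>}, B'))"

text \<open>\<open>F\<close> is the fingerprint, from which the sets \<open>T\<close> and
  \<open>U\<close> of all rounds are drawn. A state depends on \<open>S\<close> only through these
  choices, of which there are \<open>4 ^ card F\<close> per round.\<close>

primrec states :: "real \<Rightarrow> nat set \<Rightarrow> nat \<Rightarrow> nat set \<Rightarrow> (nat set \<times> nat set) set" where
  "states \<theta> V 0 F = {(V, {})}"
| "states \<theta> V (Suc i) F = (\<lambda>(p, q). refine \<theta> p q) ` (states \<theta> V i F \<times> (Pow F \<times> Pow F))"

definition heavy :: "real \<Rightarrow> nat set \<times> nat set \<Rightarrow> nat set" where
  "heavy \<theta> p = {x \<in> fst p. \<theta> \<le> real (card ((+) x ` fst p - snd p))}"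

lemma finite_states: "finite F \<Longrightarrow> finite (states \<theta> V i F)"
  by (induction i) auto

lemma card_states:
  assumes "finite F"
  shows "card (states \<theta> V i F) \<le> (4 ^ i) ^ card F"
proof (induction i)
  case (Suc i)
  have "card (states \<theta> V (Suc i) F) \<le> card (states \<theta> V i F \<times> (Pow F \<times> Pow F))"
    using assms by (simp only: states.simps) (intro card_image_le, auto simp: finite_states)
  also have "\<dots> = card (states \<theta> V i F) * 4 ^ card F"
    using assms by (simp add: card_cartesian_product card_Pow flip: power_mult_distrib)
  also have "\<dots> \<le> (4 ^ i) ^ card F * 4 ^ card F"
    using Suc by simp
  finally show ?case by (simp add: power_mult_distrib mult.commute)
qed simp

lemma states_mono: "F \<subseteq> F' \<Longrightarrow> states \<theta> V i F \<subseteq> states \<theta> V i F'"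
proof (induction i)
  case (Suc i)
  then have "states \<theta> V i F \<times> (Pow F \<times> Pow F) \<subseteq> states \<theta> V i F' \<times> (Pow F' \<times> Pow F')"
    by blast
  then show ?case by (simp only: states.simps) (rule image_mono)
qed simp

text \<open>Refining by two empty sets changes nothing, because \<open>0 < \<theta>\<close>. A
  process that stops early can thus be padded to a fixed number of rounds.\<close>

lemma states_subset_states_Suc:
  assumes "\<theta> > 0"
  shows "states \<theta> V i F \<subseteq> states \<theta> V (Suc i) F"
proof
  fix p assume p: "p \<in> states \<theta> V i F"
  have "p = refine \<theta> p ({}, {})"
    using assms by (cases p) (simp add: refine_def sumset_def)
  with p show "p \<in> states \<theta> V (Suc i) F"
    by (auto intro!: rev_image_eqI[of "(p, ({}, {}))"])
qed

text \<open>Double counting of the pairs from \<open>T\<close> and \<open>A\<close> whose sum lies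
  outside \<open>B\<close>. Heaviness yields at least \<open>t * \<theta>'\<close> of them, and at
  most \<open>t * \<theta>' / 4\<close> stay missing, by the choice of \<open>A'\<close>. Each
  element deleted from \<open>A\<close> or added to \<open>B\<close> accounts for at most
  \<open>t\<close> of the others.\<close>

lemma refine_step:
  fixes \<theta> \<theta>' :: real and t :: nat
  assumes A: "finite A" and SA: "S \<subseteq> A" and BS: "B \<subseteq> sumset S S" and \<theta>: "\<theta> > 0" and t: "t \<ge> 1"
    and heavy: "t \<le> card (heavy \<theta>' (A, B) \<inter> S)"
    and \<theta>': "card A * \<theta> \<le> t * \<theta>' / 4"
  obtains T U A' B' where "T \<subseteq> S" "U \<subseteq> S" "card T = t" "\<theta> * card U \<le> card (sumset S S)"
    "refine \<theta> (A, B) (T, U) = (A', B')" "S \<subseteq> A'" "A' \<subseteq> A" "B' \<subseteq> sumset S S"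
    "real (card A') - card B' \<le> real (card A) - card B - 3 / 4 * \<theta>'"
proof -
  have S: "finite S" using A SA finite_subset by blast
  then have B: "finite B" using BS finite_subset finite_sumset by blast
  obtain T where T: "T \<subseteq> heavy \<theta>' (A, B) \<inter> S" "card T = t" "finite T"
    using heavy obtain_subset_with_card_n by metis
  obtain U where U: "U \<subseteq> S" "\<theta> * card U \<le> card (sumset T U - B)"
    and sat: "\<forall>y\<in>S. card ((+) y ` T - (B \<union> sumset T U)) < \<theta>"
    using exists_saturating_subset[OF S \<open>finite T\<close> \<theta>] by metis
  have fU: "finite U" using U S finite_subset by blast
  define B' where "B' = B \<union> sumset T U"
  define A' where "A' = {y \<in> A. real (card ((+) y ` T - B')) < \<theta>}"
  have TS: "T \<subseteq> S" using T by blast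
  have TU: "sumset T U \<subseteq> sumset S S" using TS U by (intro sumset_mono)
  have fB': "finite B'" using B T fU by (simp add: B'_def)
  have 1: "\<theta> * card U \<le> card (sumset S S)"
  proof -
    have "card (sumset T U - B) \<le> card (sumset S S)"
      using TU S by (intro card_mono) auto
    with U(2) show ?thesis by linarith
  qed
  have A'A: "A' \<subseteq> A" by (auto simp: A'_def)
  have SA': "S \<subseteq> A'" using sat SA by (auto simp: A'_def B'_def)
  have B'S: "B' \<subseteq> sumset S S" using BS TU by (auto simp: B'_def)
  \<comment> \<open>A pair counted by \<open>P\<close> is still missing (\<open>P1\<close>), has lost its element \<open>y\<close> (\<open>P2\<close>),
    or has its sum newly in \<open>B'\<close> (\<open>P3\<close>).\<close>
  define P where "P = {(\<tau>, y). \<tau> \<in> T \<and> y \<in> A \<and> \<tau> + y \<notin> B}"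
  define P1 where "P1 = {(y, \<tau>). y \<in> A' \<and> \<tau> \<in> T \<and> y + \<tau> \<notin> B'}"
  define P2 where "P2 = T \<times> (A - A')"
  define P3 where "P3 = {(\<tau>, y). \<tau> \<in> T \<and> y \<in> A \<and> \<tau> + y \<in> B' - B}"
  have P_Sigma: "P = Sigma T (\<lambda>\<tau>. {y \<in> A. \<tau> + y \<notin> B})" by (auto simp: P_def)
  have P1_Sigma: "P1 = Sigma A' (\<lambda>y. {\<tau> \<in> T. y + \<tau> \<notin> B'})" by (auto simp: P1_def)
  have P3_Sigma: "P3 = Sigma T (\<lambda>\<tau>. {y \<in> A. \<tau> + y \<in> B' - B})" by (auto simp: P3_def)
  have fA': "finite A'" using A A'A finite_subset by blast
  have "t * \<theta>' = (\<Sum>\<tau>\<in>T. \<theta>')" using T by simp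
  also have "\<dots> \<le> (\<Sum>\<tau>\<in>T. real (card ((+) \<tau> ` A - B)))"
    using T by (intro sum_mono) (auto simp: heavy_def)
  also have "\<dots> = card P"
    unfolding P_Sigma using T A by (simp add: card_SigmaI card_translate_diff)
  finally have cP: "t * \<theta>' \<le> card P" .
  have "real (card P1) = (\<Sum>y\<in>A'. real (card ((+) y ` T - B')))"
    unfolding P1_Sigma using T fA' by (simp add: card_SigmaI card_translate_diff)
  also have "\<dots> \<le> (\<Sum>y\<in>A'. \<theta>)"
    by (intro sum_mono) (auto simp: A'_def)
  also have "\<dots> \<le> card A * \<theta>"
    using A A'A \<theta> by (simp add: card_mono)
  finally have cP1: "card P1 \<le> card A * \<theta>" .
  have cP2: "card P2 = t * (card A - card A')"
    using T A A'A fA' by (simp add: P2_def card_cartesian_product card_Diff_subset)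
  have "card P3 = (\<Sum>\<tau>\<in>T. card {y \<in> A. \<tau> + y \<in> B' - B})"
    unfolding P3_Sigma using T A by (simp add: card_SigmaI)
  also have "\<dots> \<le> (\<Sum>\<tau>\<in>T. card (B' - B))"
  proof (rule sum_mono)
    fix \<tau>
    show "card {y \<in> A. \<tau> + y \<in> B' - B} \<le> card (B' - B)"
      using fB' by (intro card_inj_on_le[of "(+) \<tau>"]) auto
  qed
  also have "\<dots> = t * (card B' - card B)"
    using T B by (simp add: B'_def card_Diff_subset)
  finally have cP3: "card P3 \<le> t * (card B' - card B)" .
  have fin: "finite P1" "finite P2" "finite P3"
    unfolding P1_Sigma P2_def P3_Sigma using T A fA' by auto
  have "P \<subseteq> prod.swap ` P1 \<union> P2 \<union> P3"
    by (force simp: P_def P1_def P2_def P3_def add.commute)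
  then have "card P \<le> card (prod.swap ` P1 \<union> P2 \<union> P3)"
    using fin by (intro card_mono) auto
  also have "\<dots> \<le> card (prod.swap ` P1) + card P2 + card P3"
    by (meson add_le_mono1 card_Un_le le_trans)
  also have "\<dots> \<le> card P1 + card P2 + card P3"
    using fin card_image_le by auto
  finally have "real (card P) \<le> card P1 + card P2 + card P3" by linarith
  moreover have "real (card P2) = t * (real (card A) - card A')"
    using cP2 A A'A by (simp add: card_mono of_nat_diff)
  moreover have "real (card P3) \<le> t * (real (card B') - card B)"
  proof -
    have "card B \<le> card B'" using fB' by (intro card_mono) (auto simp: B'_def)
    then show ?thesis using cP3 by (metis of_nat_diff of_nat_le_iff of_nat_mult)
  qed
  ultimately have "t * \<theta>' \<le> t * \<theta>' / 4 + t * (real (card A) - card A') + t * (real (card B') - card B)"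
    using cP cP1 \<theta>' by linarith
  then have "t * (3 / 4 * \<theta>') \<le> t * ((real (card A) - card A') + (real (card B') - card B))"
    by (simp add: algebra_simps)
  then have pot: "3 / 4 * \<theta>' \<le> (real (card A) - card A') + (real (card B') - card B)"
    using t by simp
  show thesis
    by (rule that[of T U A' B'])
       (use TS U T 1 SA' A'A B'S pot in \<open>auto simp: refine_def A'_def B'_def Let_def\<close>)
qed

text \<open>The sets \<open>min A + A\<close> and \<open>max A + A\<close> meet only in \<open>min A + max A\<close>.\<close>

lemma card_le_of_few_missing_sums:
  fixes A B :: "nat set" and \<theta> :: real
  assumes A: "finite A" and B: "finite B" and \<theta>: "\<theta> \<ge> 0"
    and few: "\<And>x. x \<in> A \<Longrightarrow> card ((+) x ` A - B) \<le> \<theta>"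
  shows "card A \<le> card B / 2 + \<theta> + 1"
proof (cases "A = {}")
  case False
  define a b where "a = Min A" and "b = Max A"
  have ab: "a \<in> A" "b \<in> A" "\<And>x. x \<in> A \<Longrightarrow> a \<le> x" "\<And>x. x \<in> A \<Longrightarrow> x \<le> b"
    using A False by (auto simp: a_def b_def)
  let ?X = "(+) a ` A" and ?Y = "(+) b ` A"
  have "?X \<inter> ?Y \<subseteq> {a + b}"
  proof
    fix z assume "z \<in> ?X \<inter> ?Y"
    then obtain u v where "u \<in> A" "v \<in> A" "z = a + u" "z = b + v" by auto
    then show "z \<in> {a + b}" using ab(3)[of v] ab(4)[of u] by simp
  qed
  then have "card (?X \<inter> ?Y) \<le> 1" using card_mono[of "{a + b}"] by auto
  moreover have "card ?X + card ?Y = card (?X \<union> ?Y) + card (?X \<inter> ?Y)"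
    using A by (intro card_Un_Int) auto
  moreover have "card ?X = card A" "card ?Y = card A" by (simp_all add: card_image)
  ultimately have "2 * card A \<le> card (?X \<union> ?Y) + 1" by linarith
  also have "card (?X \<union> ?Y) \<le> card (B \<union> (?X - B) \<union> (?Y - B))"
    using A B by (intro card_mono) auto
  also have "\<dots> \<le> card B + card (?X - B) + card (?Y - B)"
    by (meson add_le_mono1 card_Un_le le_trans)
  finally have "2 * card A \<le> card B + card (?X - B) + card (?Y - B) + 1" by simp
  then have "2 * real (card A) \<le> card B + real (card (?X - B)) + card (?Y - B) + 1"
    by linarith
  then show ?thesis using few[OF ab(1)] few[OF ab(2)] by linarith
qed (use \<theta> in simp)

section \<open>Iteration and the container theorem\<close>

text \<open>While at least \<open>t\<close> elements of \<open>S\<close> are heavy, a round is run.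
  It costs \<open>t\<close> elements for \<open>T\<close> and at most
  \<open>8 * n / (\<epsilon> * t)\<close> for \<open>U\<close>, because \<open>card U\<close> times
  \<open>\<epsilon> * t / 4\<close> is at most \<open>card (sumset S S) \<le> 2 * n\<close>.\<close>

lemma exists_light_state:
  fixes \<epsilon> :: real and n t i :: nat
  assumes \<epsilon>: "\<epsilon> > 0" and n: "n \<ge> 1" and t: "t \<ge> 1" and S: "S \<subseteq> {1..n}"
  shows "\<exists>F A B. F \<subseteq> S \<and> card F \<le> i * (t + 8 * n / (\<epsilon> * t)) \<and>
    (A, B) \<in> states (\<epsilon> * t / 4) {1..n} i F \<and> S \<subseteq> A \<and> A \<subseteq> {1..n} \<and> B \<subseteq> sumset S S \<and>
    (card (heavy (\<epsilon> * n) (A, B) \<inter> S) < t \<or> real (card A) - card B \<le> n - i * (3 / 4 * (\<epsilon> * n)))"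
proof (induction i)
  case 0
  show ?case using S by (intro exI[of _ "{}"] exI[of _ "{1..n}"]) simp
next
  case (Suc i)
  \<comment> \<open>As \<open>card A \<le> n\<close>, this \<open>?\<theta>\<close> meets the
    condition \<open>card A * ?\<theta> \<le> t * (\<epsilon> * n) / 4\<close> of a refinement
    step.\<close>
  let ?p = "t + 8 * n / (\<epsilon> * t)" and ?\<theta> = "\<epsilon> * t / 4"
  have p: "?p \<ge> 0" using \<epsilon> by simp
  have \<theta>: "?\<theta> > 0" using \<epsilon> t by simp
  obtain F A B where IH: "F \<subseteq> S" "card F \<le> i * ?p"
    "(A, B) \<in> states ?\<theta> {1..n} i F" "S \<subseteq> A" "A \<subseteq> {1..n}" "B \<subseteq> sumset S S"
    "card (heavy (\<epsilon> * n) (A, B) \<inter> S) < t \<or> real (card A) - card B \<le> n - i * (3 / 4 * (\<epsilon> * n))"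
    using Suc by blast
  show ?case
  proof (cases "card (heavy (\<epsilon> * n) (A, B) \<inter> S) < t")
    case True
    have "card F \<le> Suc i * ?p"
      using IH(2) mult_right_mono[OF _ p, of "real i" "real (Suc i)"] by linarith
    moreover have "(A, B) \<in> states ?\<theta> {1..n} (Suc i) F"
      using states_subset_states_Suc[OF \<theta>] IH(3) by blast
    ultimately show ?thesis using IH True by blast
  next
    case False
    have fA: "finite A" using IH(5) finite_subset by blast
    have fS: "finite S" using S finite_subset by blast
    have "card A \<le> n" using IH(5) card_mono[of "{1..n}" A] by simp
    then have "card A * ?\<theta> \<le> n * ?\<theta>" using \<theta> by (intro mult_right_mono) auto
    then have "card A * ?\<theta> \<le> t * (\<epsilon> * n) / 4" by (simp add: algebra_simps)
    then obtain T U A' B' where step: "T \<subseteq> S" "U \<subseteq> S" "card T = t"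
      "?\<theta> * card U \<le> card (sumset S S)" "refine ?\<theta> (A, B) (T, U) = (A', B')"
      "S \<subseteq> A'" "A' \<subseteq> A" "B' \<subseteq> sumset S S"
      "real (card A') - card B' \<le> real (card A) - card B - 3 / 4 * (\<epsilon> * n)"
      using refine_step[OF fA IH(4,6) \<theta> t, of "\<epsilon> * n"] False by (metis not_less)
    have "?\<theta> * card U \<le> 2 * n" using step(4) card_sumset_le[OF S] by linarith
    then have U: "card U \<le> 8 * n / (\<epsilon> * t)" using \<epsilon> t by (simp add: field_simps)
    let ?F = "F \<union> T \<union> U"
    have "card ?F \<le> card F + card T + card U"
      by (meson add_le_mono1 card_Un_le le_trans)
    then have "real (card ?F) \<le> real (card F) + real (card T) + real (card U)" by linarith
    also have "\<dots> \<le> i * ?p + ?p" using IH(2) U step(3) by linarith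
    also have "\<dots> = Suc i * ?p" by (simp only: of_nat_Suc distrib_right mult_1 add.commute)
    finally have "card ?F \<le> Suc i * ?p" .
    moreover have "(A, B) \<in> states ?\<theta> {1..n} i ?F"
      using IH(3) states_mono[of F ?F] by blast
    then have "(A', B') \<in> states ?\<theta> {1..n} (Suc i) ?F"
      using step(5) by (auto intro!: rev_image_eqI[of "((A, B), (T, U))"])
    moreover have "real (card A') - card B' \<le> n - Suc i * (3 / 4 * (\<epsilon> * n))"
    proof -
      have "Suc i * (3 / 4 * (\<epsilon> * n)) = i * (3 / 4 * (\<epsilon> * n)) + 3 / 4 * (\<epsilon> * n)"
        by (simp only: of_nat_Suc distrib_right mult_1 add.commute)
      then show ?thesis using step(9) IH(7) False by linarith
    qed
    ultimately show ?thesis using IH step by (meson Un_least order_trans)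
  qed
qed

lemma containers:
  fixes \<epsilon> :: real
  assumes "0 < \<epsilon>" "\<epsilon> \<le> 1"
  obtains D :: real where "D \<ge> 1"
    "\<And>n. n \<ge> 1 \<Longrightarrow> \<exists>\<C>. (\<forall>F. finite F \<longrightarrow> finite (\<C> F) \<and> card (\<C> F) \<le> D ^ card F) \<and>
       (\<forall>S \<subseteq> {1..n}. \<exists>F \<subseteq> S. card F \<le> D * sqrt n \<and>
          (\<exists>A\<in>\<C> F. finite A \<and> S - F \<subseteq> A \<and> card A \<le> card (sumset S S) / 2 + \<epsilon> * n + 1))"
proof -
  \<comment> \<open>After more than \<open>4 / \<epsilon>\<close> effective rounds
    \<open>card A - card B\<close> would have dropped from \<open>n\<close> by more than
    \<open>3 * n\<close>, whereas \<open>card B \<le> 2 * n\<close>.\<close>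
  define I where "I = nat \<lceil>4 / \<epsilon>\<rceil> + 1"
  \<comment> \<open>The power of 4 counts states per fingerprint element; the other terms bound the
    fingerprint in units of \<open>sqrt n\<close>.\<close>
  define D :: real where "D = 4 ^ I + I * (10 / \<epsilon>) + 2"
  have I: "I > 4 / \<epsilon>" unfolding I_def by linarith
  have D1: "D \<ge> 1" "D \<ge> 4 ^ I" using assms by (auto simp: D_def add_increasing add_increasing2)
  have "\<exists>\<C>. (\<forall>F. finite F \<longrightarrow> finite (\<C> F) \<and> card (\<C> F) \<le> D ^ card F) \<and>
       (\<forall>S \<subseteq> {1..n}. \<exists>F \<subseteq> S. card F \<le> D * sqrt n \<and>
          (\<exists>A\<in>\<C> F. finite A \<and> S - F \<subseteq> A \<and> card A \<le> card (sumset S S) / 2 + \<epsilon> * n + 1))"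
    if n: "n \<ge> 1" for n :: nat
  proof -
    \<comment> \<open>This balances the costs of \<open>T\<close> and \<open>U\<close>, which are of
      order \<open>t\<close> and \<open>n / t\<close>.\<close>
    define t where "t = nat \<lceil>sqrt n\<rceil>"
    have sn: "sqrt n \<ge> 1" using n by simp
    have t1: "t \<ge> 1" "t \<ge> sqrt n" "t \<le> 2 * sqrt n" using sn unfolding t_def by linarith+
    let ?\<theta> = "\<epsilon> * t / 4" and ?p = "t + 8 * n / (\<epsilon> * t)"
    \<comment> \<open>The container omits all heavy elements, so \<open>B\<close> nearly covers
      every remaining translate. The fewer than \<open>t\<close> heavy elements in \<open>S\<close>
      join the fingerprint.\<close>
    define light where "light = (\<lambda>p. fst p - heavy (\<epsilon> * n) p)"
    define \<C> where "\<C> = (\<lambda>F. light ` states ?\<theta> {1..n} I F)"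
    have p: "?p \<le> 10 / \<epsilon> * sqrt n"
    proof -
      have "8 * n / (\<epsilon> * t) \<le> 8 * n / (\<epsilon> * sqrt n)"
        using t1 sn assms by (intro divide_left_mono mult_left_mono mult_pos_pos) linarith+
      also have "\<dots> = 8 / \<epsilon> * sqrt n"
        using sn assms by (simp add: field_simps)
      finally have "?p \<le> 2 * sqrt n + 8 / \<epsilon> * sqrt n" using t1(3) by linarith
      moreover have "2 * sqrt n \<le> 2 / \<epsilon> * sqrt n"
        using assms sn by (intro mult_right_mono) (auto simp: field_simps)
      moreover have "10 / \<epsilon> * sqrt n = 2 / \<epsilon> * sqrt n + 8 / \<epsilon> * sqrt n"
        by (simp flip: distrib_right add_divide_distrib)
      ultimately show ?thesis by linarith
    qed
    have "finite (\<C> F) \<and> card (\<C> F) \<le> D ^ card F" if F: "finite F" for F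
    proof
      show "finite (\<C> F)" using F by (simp add: \<C>_def finite_states)
      have "card (\<C> F) \<le> card (states ?\<theta> {1..n} I F)"
        unfolding \<C>_def using F by (intro card_image_le finite_states)
      also have "\<dots> \<le> (4 ^ I) ^ card F" using F by (rule card_states)
      finally have "real (card (\<C> F)) \<le> (4 ^ I) ^ card F"
        by (metis of_nat_le_iff of_nat_power of_nat_numeral)
      also have "\<dots> \<le> D ^ card F" using D1 by (intro power_mono) auto
      finally show "card (\<C> F) \<le> D ^ card F" .
    qed
    moreover have "\<exists>F \<subseteq> S. card F \<le> D * sqrt n \<and>
          (\<exists>A\<in>\<C> F. finite A \<and> S - F \<subseteq> A \<and> card A \<le> card (sumset S S) / 2 + \<epsilon> * n + 1)"
      if S: "S \<subseteq> {1..n}" for S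
    proof -
      have fS: "finite S" using S finite_subset by blast
      obtain F A B where st: "F \<subseteq> S" "card F \<le> I * ?p"
        "(A, B) \<in> states ?\<theta> {1..n} I F" "S \<subseteq> A" "A \<subseteq> {1..n}" "B \<subseteq> sumset S S"
        "card (heavy (\<epsilon> * n) (A, B) \<inter> S) < t \<or> real (card A) - card B \<le> n - I * (3 / 4 * (\<epsilon> * n))"
        using exists_light_state[OF \<open>0 < \<epsilon>\<close> n t1(1) S, of I] by blast
      have fA: "finite A" using st(5) finite_subset by blast
      have fB: "finite B" using st(6) fS finite_subset finite_sumset by blast
      have cB: "card B \<le> card (sumset S S)" using st(6) fS by (intro card_mono) auto
      have cB2: "card B \<le> 2 * n" using cB card_sumset_le[OF S] by linarith
      have "I * (3 / 4 * (\<epsilon> * n)) > 3 * n"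
      proof -
        have "I * \<epsilon> > 4" using I assms by (simp add: field_simps)
        then have "(I * \<epsilon>) * (3 / 4 * n) > 4 * (3 / 4 * n)"
          using n by (intro mult_strict_right_mono) auto
        then show ?thesis by (simp add: algebra_simps)
      qed
      then have H: "card (heavy (\<epsilon> * n) (A, B) \<inter> S) < t" using st(7) cB2 by linarith
      let ?F = "F \<union> (heavy (\<epsilon> * n) (A, B) \<inter> S)"
      have "card ?F \<le> card F + card (heavy (\<epsilon> * n) (A, B) \<inter> S)" by (rule card_Un_le)
      then have "real (card ?F) \<le> card F + t" using H by linarith
      also have "\<dots> \<le> I * (10 / \<epsilon> * sqrt n) + 2 * sqrt n"
        using st(2) t1 p mult_left_mono[OF p, of "real I"] by linarith
      also have "\<dots> \<le> D * sqrt n" using sn by (simp add: D_def algebra_simps)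
      finally have cF: "card ?F \<le> D * sqrt n" .
      have "(A, B) \<in> states ?\<theta> {1..n} I ?F" using st(3) states_mono[of F ?F] by blast
      then have mem: "light (A, B) \<in> \<C> ?F" by (simp add: \<C>_def)
      have "card (light (A, B)) \<le> card B / 2 + \<epsilon> * n + 1"
      proof (rule card_le_of_few_missing_sums)
        fix x assume x: "x \<in> light (A, B)"
        have "card ((+) x ` light (A, B) - B) \<le> card ((+) x ` A - B)"
          using fA by (intro card_mono) (auto simp: light_def)
        moreover have "card ((+) x ` A - B) \<le> \<epsilon> * n"
          using x by (auto simp: light_def heavy_def)
        ultimately show "card ((+) x ` light (A, B) - B) \<le> \<epsilon> * n" by linarith
      qed (use fA fB assms in \<open>auto simp: light_def\<close>)
      then have "card (light (A, B)) \<le> card (sumset S S) / 2 + \<epsilon> * n + 1"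
        using cB by linarith
      moreover have "S - ?F \<subseteq> light (A, B)" using st(4) by (auto simp: light_def)
      moreover have "finite (light (A, B))" using fA by (simp add: light_def)
      ultimately show ?thesis using cF mem st(1)
        by (intro exI[of _ ?F]) auto
    qed
    ultimately show ?thesis by blast
  qed
  with D1 that show thesis by blast
qed

section \<open>Exponential bounds for weighted sums over families of sets\<close>

text \<open>Expand the product of all \<open>1 + f x\<close> and use
  \<open>1 + u \<le> exp u\<close>.\<close>

lemma sum_prod_Pow_le_exp:
  fixes f :: "'a \<Rightarrow> real"
  assumes "finite A" "\<And>x. x \<in> A \<Longrightarrow> 0 \<le> f x"
  shows "(\<Sum>X\<in>Pow A. \<Prod>x\<in>X. f x) \<le> exp (\<Sum>x\<in>A. f x)"
proof -
  have "(\<Sum>X\<in>Pow A. \<Prod>x\<in>X. f x) = (\<Prod>x\<in>A. f x + 1)"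
    using prod_add[OF assms(1), of f "\<lambda>_. 1"] by simp
  also have "\<dots> \<le> (\<Prod>x\<in>A. exp (f x))"
    using assms exp_ge_add_one_self by (intro prod_mono) (auto simp: add.commute)
  finally show ?thesis using assms by (simp add: exp_sum)
qed

text \<open>Induction on the sharper bound \<open>1 - exp (- s * n)\<close> for \<open>s\<close>
  times the sum; the step is \<open>s + 1 \<le> exp s\<close>.\<close>

lemma sum_exp_neg_le:
  fixes s :: real
  assumes s: "s > 0"
  shows "(\<Sum>x=1..n. exp (- s * real x)) \<le> 1 / s"
proof -
  have "s * (\<Sum>x=1..n. exp (- s * real x)) \<le> 1 - exp (- s * n)"
  proof (induction n)
    case (Suc n)
    have "(s + 1) * exp (- s * Suc n) \<le> exp s * exp (- s * Suc n)"
      using exp_ge_add_one_self[of s] by (intro mult_right_mono) (auto simp: add.commute)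
    also have "\<dots> = exp (- s * n)" by (simp add: algebra_simps flip: exp_add)
    finally show ?case using Suc by (simp add: algebra_simps)
  qed simp
  also have "\<dots> \<le> 1" by simp
  finally show ?thesis using s by (simp add: field_simps)
qed

lemma sets_of_bounded_sum_subset:
  "{X::nat set. finite X \<and> X \<subseteq> {1..} \<and> \<Sum>X \<le> k} \<subseteq> Pow {1..k}"
proof clarify
  fix X :: "nat set" and x
  assume "finite X" "X \<subseteq> {1..}" "\<Sum>X \<le> k" "x \<in> X"
  then show "x \<in> {1..k}" using member_le_sum[of x X "\<lambda>x. x"] by auto
qed

lemma finite_sets_of_bounded_sum: "finite {X::nat set. finite X \<and> X \<subseteq> {1..} \<and> \<Sum>X \<le> k}"
  using sets_of_bounded_sum_subset by (rule finite_subset) simp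

text \<open>Rankin's trick: the factor \<open>exp (s (k - \<Sum>X)) \<ge> 1\<close> turns the sum into an Euler product.\<close>

lemma sum_weight_bounded_sum:
  fixes w s :: real and k :: nat
  assumes w: "w \<ge> 0" and s: "s > 0"
    and \<F>: "\<F> \<subseteq> {X. finite X \<and> X \<subseteq> {1..} \<and> \<Sum>X \<le> k}"
  shows "(\<Sum>X\<in>\<F>. w ^ card X) \<le> exp (s * k + w / s)"
proof -
  have sub: "\<F> \<subseteq> Pow {1..k}" using \<F> sets_of_bounded_sum_subset by (rule order_trans)
  have "(\<Sum>X\<in>\<F>. w ^ card X) \<le> (\<Sum>X\<in>\<F>. exp (s * k) * (\<Prod>x\<in>X. w * exp (- s * real x)))"
  proof (rule sum_mono)
    fix X assume "X \<in> \<F>"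
    then have X: "finite X" "\<Sum>X \<le> k" using \<F> by auto
    have "(\<Prod>x\<in>X. w * exp (- s * real x)) = w ^ card X * exp (- s * \<Sum>X)"
      using X by (simp add: prod.distrib exp_sum sum_distrib_left)
    then have "exp (s * k) * (\<Prod>x\<in>X. w * exp (- s * real x)) = w ^ card X * exp (s * (k - \<Sum>X))"
      using X by (simp add: algebra_simps of_nat_diff del: of_nat_sum flip: exp_add)
    moreover have "1 \<le> exp (s * (k - \<Sum>X))" using s by simp
    ultimately show "w ^ card X \<le> exp (s * k) * (\<Prod>x\<in>X. w * exp (- s * real x))"
      using w by (simp add: mult_le_cancel_left1)
  qed
  also have "\<dots> = exp (s * k) * (\<Sum>X\<in>\<F>. \<Prod>x\<in>X. w * exp (- s * real x))"
    by (simp add: sum_distrib_left)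
  also have "\<dots> \<le> exp (s * k) * (\<Sum>X\<in>Pow {1..k}. \<Prod>x\<in>X. w * exp (- s * real x))"
    using sub w by (intro mult_left_mono sum_mono2) (auto intro!: prod_nonneg)
  also have "\<dots> \<le> exp (s * k) * exp (\<Sum>x=1..k. w * exp (- s * real x))"
    using w by (intro mult_left_mono sum_prod_Pow_le_exp) auto
  also have "\<dots> = exp (s * k + w * (\<Sum>x=1..k. exp (- s * real x)))"
    by (simp add: exp_add sum_distrib_left)
  also have "\<dots> \<le> exp (s * k + w * (1 / s))"
    using w sum_exp_neg_le[OF s, of k] by (simp only: exp_le_cancel_iff) (intro add_left_mono mult_left_mono, auto)
  finally show ?thesis by simp
qed

text \<open>If all \<open>X\<close> are small, a factor \<open>M\<close> per element costs little in
  total, while the reduced weight \<open>w / M\<close> makes the exponential bound for the remaining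
  sum small.\<close>

lemma sum_weight_few:
  fixes w M r :: real
  assumes "w \<ge> 0" "M \<ge> 1" "\<And>X. X \<in> \<F> \<Longrightarrow> card X \<le> r"
  shows "(\<Sum>X\<in>\<F>. w ^ card X) \<le> M powr r * (\<Sum>X\<in>\<F>. (w / M) ^ card X)"
  unfolding sum_distrib_left
proof (rule sum_mono)
  fix X assume X: "X \<in> \<F>"
  have "w ^ card X = M ^ card X * (w / M) ^ card X"
    using assms by (simp add: power_divide)
  also have "\<dots> \<le> M powr r * (w / M) ^ card X"
  proof (rule mult_right_mono)
    show "M ^ card X \<le> M powr r"
      using assms X powr_mono[of "real (card X)" r M] by (simp add: powr_realpow)
  qed (use assms in auto)
  finally show "w ^ card X \<le> M powr r * (w / M) ^ card X" .
qed

section \<open>Counting sets through their decompositions\<close>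

text \<open>Each \<open>S\<close> is charged to a tuple \<open>(L, F, A, R)\<close>, and the
  multiplicative weight makes the sum factorise. The choice of \<open>A\<close> turns the weight
  \<open>z\<close> per element of \<open>F\<close> into \<open>D * z\<close>; the subsets
  \<open>R\<close> of one container contribute at most \<open>exp (z * a)\<close>.\<close>

lemma card_mult_weight_le:
  fixes z a D :: real and \<S> \<L> \<F> :: "'a set set"
  assumes z: "z \<ge> 0" and fin: "finite \<S>" "finite \<L>" "finite \<F>"
    and \<C>: "\<And>F. F \<in> \<F> \<Longrightarrow> finite (\<C> F) \<and> card (\<C> F) \<le> D ^ card F"
    and A: "\<And>F A. F \<in> \<F> \<Longrightarrow> A \<in> \<C> F \<Longrightarrow> finite A \<and> card A \<le> a"
    and dec: "\<And>S. S \<in> \<S> \<Longrightarrow> \<exists>L\<in>\<L>. \<exists>F\<in>\<F>. \<exists>A\<in>\<C> F. \<exists>R\<in>Pow A.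
        L \<union> F \<union> R = S \<and> l = card L + card F + card R"
  shows "card \<S> * z ^ l \<le> (\<Sum>L\<in>\<L>. z ^ card L) * (\<Sum>F\<in>\<F>. (D * z) ^ card F) * exp (z * a)"
proof -
  let ?T = "SIGMA L:\<L>. SIGMA F:\<F>. SIGMA A:\<C> F. Pow A"
  let ?g = "\<lambda>(L, F, A, R). z ^ card L * (z ^ card F * z ^ card R)"
  have finT: "finite ?T" using fin \<C> A by (intro finite_SigmaI) auto
  have "card \<S> * z ^ l = (\<Sum>S\<in>\<S>. z ^ l)" by simp
  also have "\<dots> \<le> sum ?g ?T"
  proof (rule sum_le_included[where i = "\<lambda>(L, F, A, R). L \<union> F \<union> R"])
    show "\<forall>S\<in>\<S>. \<exists>y\<in>?T. (case y of (L, F, A, R) \<Rightarrow> L \<union> F \<union> R) = S \<and> z ^ l \<le> ?g y"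
    proof
      fix S assume "S \<in> \<S>"
      then obtain L F A R where *: "L \<in> \<L>" "F \<in> \<F>" "A \<in> \<C> F" "R \<in> Pow A"
        "L \<union> F \<union> R = S" "l = card L + card F + card R"
        using dec by meson
      then show "\<exists>y\<in>?T. (case y of (L, F, A, R) \<Rightarrow> L \<union> F \<union> R) = S \<and> z ^ l \<le> ?g y"
        by (intro bexI[of _ "(L, F, A, R)"]) (auto simp: power_add)
    qed
  qed (use fin finT z in auto)
  also have "\<dots> = (\<Sum>L\<in>\<L>. \<Sum>F\<in>\<F>. \<Sum>A\<in>\<C> F. \<Sum>R\<in>Pow A. z ^ card L * (z ^ card F * z ^ card R))"
  proof -
    have inner: "(\<Sum>(A, R)\<in>Sigma (\<C> F) Pow. h A R) = (\<Sum>A\<in>\<C> F. \<Sum>R\<in>Pow A. h A R)"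
      if "F \<in> \<F>" for F and h :: "'a set \<Rightarrow> 'a set \<Rightarrow> real"
      using \<C> A that by (intro sum.Sigma[symmetric]) auto
    have "(\<Sum>(F, A, R)\<in>(SIGMA F:\<F>. SIGMA A:\<C> F. Pow A). h F A R)
        = (\<Sum>F\<in>\<F>. \<Sum>A\<in>\<C> F. \<Sum>R\<in>Pow A. h F A R)" for h :: "'a set \<Rightarrow> 'a set \<Rightarrow> 'a set \<Rightarrow> real"
      using fin \<C> A by (subst sum.Sigma[symmetric]) (auto simp: inner intro!: finite_SigmaI)
    moreover have "finite (SIGMA F:\<F>. SIGMA A:\<C> F. Pow A)"
      using fin \<C> A by (intro finite_SigmaI) auto
    ultimately show ?thesis using fin by (subst sum.Sigma[symmetric]) auto
  qed
  also have "\<dots> = (\<Sum>L\<in>\<L>. z ^ card L) *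
      (\<Sum>F\<in>\<F>. z ^ card F * (\<Sum>A\<in>\<C> F. \<Sum>R\<in>Pow A. z ^ card R))"
    by (simp only: sum_distrib_right) (simp only: sum_distrib_left)
  also have "\<dots> \<le> (\<Sum>L\<in>\<L>. z ^ card L) * (\<Sum>F\<in>\<F>. z ^ card F * (D ^ card F * exp (z * a)))"
  proof (intro mult_left_mono sum_mono)
    fix F assume F: "F \<in> \<F>"
    have "(\<Sum>A\<in>\<C> F. \<Sum>R\<in>Pow A. z ^ card R) \<le> (\<Sum>A\<in>\<C> F. exp (z * a))"
    proof (rule sum_mono)
      fix A' assume A': "A' \<in> \<C> F"
      have "(\<Sum>R\<in>Pow A'. z ^ card R) \<le> exp (card A' * z)"
        using sum_prod_Pow_le_exp[of A' "\<lambda>_. z"] A[OF F A'] z by simp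
      also have "\<dots> \<le> exp (z * a)"
        using A[OF F A'] mult_left_mono[of "real (card A')" a z] z by (simp add: mult.commute)
      finally show "(\<Sum>R\<in>Pow A'. z ^ card R) \<le> exp (z * a)" .
    qed
    also have "\<dots> \<le> D ^ card F * exp (z * a)"
      using \<C>[OF F] by (simp add: mult_right_mono)
    finally show "(\<Sum>A\<in>\<C> F. \<Sum>R\<in>Pow A. z ^ card R) \<le> D ^ card F * exp (z * a)" .
  qed (use z in \<open>auto intro!: sum_nonneg\<close>)
  also have "\<dots> = (\<Sum>L\<in>\<L>. z ^ card L) * (\<Sum>F\<in>\<F>. (D * z) ^ card F) * exp (z * a)"
    by (simp add: sum_distrib_left sum_distrib_right power_mult_distrib algebra_simps)
  finally show ?thesis .
qed

section \<open>The counting bounds for large and for small c\<close>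

text \<open>Rankin's bound with \<open>s = l / k\<close> and weight \<open>l ^ 2 / k\<close>, for
  which both terms of the exponent equal \<open>l\<close>.\<close>

lemma card_sets_of_sum_le:
  fixes k l :: nat
  assumes k: "k \<ge> 1" and l: "l \<ge> 1"
    and \<S>: "\<S> \<subseteq> {S. S \<subseteq> {1..} \<and> card S = l \<and> \<Sum>S = k}"
  shows "card \<S> \<le> (exp 2 * k / l ^ 2) ^ l"
proof -
  have S: "finite S" "S \<subseteq> {1..}" "card S = l" "\<Sum>S = k" if "S \<in> \<S>" for S
    using that \<S> l card_ge_0_finite[of S] by auto
  define w :: real where "w = l ^ 2 / k"
  have w: "w > 0" using k l by (simp add: w_def)
  have "card \<S> * w ^ l = (\<Sum>S\<in>\<S>. w ^ card S)"
    by (simp add: S)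
  also have "\<dots> \<le> exp (l / k * k + w / (l / k))"
    using S w k l by (intro sum_weight_bounded_sum) auto
  also have "l / k * k + w / (l / k) = l * 2"
    using k l by (simp add: w_def power2_eq_square)
  also have "exp (real (l * 2)) = exp 2 ^ l"
    by (simp add: exp_of_nat_mult)
  finally have "card \<S> \<le> exp 2 ^ l / w ^ l"
    using w by (simp add: field_simps)
  also have "\<dots> = (exp 2 * k / l ^ 2) ^ l"
    by (simp add: w_def flip: power_divide)
  finally show ?thesis .
qed

text \<open>A set splits into its elements above \<open>n\<close>, a fingerprint \<open>F\<close>
  and a rest \<open>R\<close> inside a container. The first two cost
  \<open>exp (5 * l / 100)\<close>; the rest gives \<open>exp (z * a) = exp l\<close>, and dividing
  by \<open>z ^ l\<close> leaves the main term \<open>(exp 1 * a / l) ^ l\<close>.\<close>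

lemma count_small_sumset:
  fixes c0 :: real
  assumes c0: "c0 > 0"
  obtains C :: real where "C > 0"
    "\<And>k l c \<S>. k \<ge> 1 \<Longrightarrow> l \<ge> 1 \<Longrightarrow> real l ^ 3 \<ge> C * real k \<Longrightarrow> c0 \<le> c \<Longrightarrow> c \<le> 5 \<Longrightarrow>
       \<S> = {S :: nat set. S \<subseteq> {1..} \<and> card S = l \<and> \<Sum>S = k \<and>
                 real (card (sumset S S)) \<le> c * real k / real l} \<Longrightarrow>
       card \<S> \<le> (2 * c * exp 1 * real k / (3 * real l ^ 2)) ^ l"
proof -
  define M where "M = 1 + 20000 / c0"
  \<comment> \<open>\<open>K\<close> makes the penalty \<open>M powr (l / K)\<close> at most
    \<open>exp (l / 100)\<close>; \<open>\<epsilon>\<close> makes the error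
    \<open>\<epsilon> * n\<close> at most \<open>c0 * (k / l) / 20\<close>.\<close>
  define K where "K = nat \<lceil>100 * ln M\<rceil> + 1"
  define \<epsilon> where "\<epsilon> = min 1 (c0 / (20 * K))"
  have M: "M \<ge> 1" "M \<ge> 20000 / c0" using c0 by (auto simp: M_def)
  have K: "real K \<ge> 100 * ln M" "K \<ge> 1" unfolding K_def by linarith+
  have \<epsilon>: "0 < \<epsilon>" "\<epsilon> \<le> 1" "\<epsilon> \<le> c0 / (20 * K)" using c0 K by (auto simp: \<epsilon>_def)
  obtain D :: real where D: "D \<ge> 1" and cont:
    "\<And>n. n \<ge> 1 \<Longrightarrow> \<exists>\<C>. (\<forall>F. finite F \<longrightarrow> finite (\<C> F) \<and> card (\<C> F) \<le> D ^ card F) \<and>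
       (\<forall>S \<subseteq> {1..n}. \<exists>F \<subseteq> S. card F \<le> D * sqrt n \<and>
          (\<exists>A\<in>\<C> F. finite A \<and> S - F \<subseteq> A \<and> card A \<le> card (sumset S S) / 2 + \<epsilon> * n + 1))"
    using containers[OF \<epsilon>(1,2)] by metis
  \<comment> \<open>\<open>M\<close> and \<open>M'\<close> are the penalties per element which keep the weights of the large
    elements and of the fingerprints small.\<close>
  define M' where "M' = 1 + 200 * K * D / c0"
  have M': "M' \<ge> 1" "M' \<ge> 200 * K * D / c0" using c0 K D by (auto simp: M'_def)
  \<comment> \<open>The terms serve, in order, to give \<open>l \<ge> 5\<close>, to bound the
    additive 1 in the container size by \<open>c0 * (k / l) / 20\<close>, and to keep
    \<open>M' powr (D * sqrt n)\<close> below \<open>exp (l / 100)\<close>.\<close>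
  define C where "C = 25 + 500 / c0 + K * (100 * D * ln M') ^ 2"
  have C: "C \<ge> 25" "C \<ge> 500 / c0" "C \<ge> K * (100 * D * ln M') ^ 2"
    using c0 by (auto simp: C_def)
  have "card \<S> \<le> (2 * c * exp 1 * real k / (3 * real l ^ 2)) ^ l"
    if k: "k \<ge> 1" and l: "l \<ge> 1" and lC: "real l ^ 3 \<ge> C * real k" and c: "c0 \<le> c" "c \<le> 5"
      and \<S>: "\<S> = {S :: nat set. S \<subseteq> {1..} \<and> card S = l \<and> \<Sum>S = k \<and>
                 real (card (sumset S S)) \<le> c * real k / real l}"
    for k l :: nat and c :: real and \<S>
  proof (cases "\<S> = {}")
    case True
    then show ?thesis using c0 c by simp
  next
    case False
    have cpos: "c > 0" using c0 c by simp
    \<comment> \<open>A member of the family has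
      \<open>l \<le> card (sumset S S) \<le> c * k / l\<close>, so \<open>k\<close> cannot be small
      compared with \<open>l ^ 2\<close>.\<close>
    have kl5: "real l / 5 \<le> k / l"
    proof -
      obtain S where "S \<in> \<S>" using False by blast
      then have S: "card S = l" "real (card (sumset S S)) \<le> c * real k / real l"
        using \<S> by auto
      have "finite S" "S \<noteq> {}" using S(1) l card_ge_0_finite by force+
      then have "real l \<le> c * (k / l)" using card_le_card_sumset[of S] S by simp
      also have "\<dots> \<le> 5 * (k / l)" using c by (intro mult_right_mono) auto
      finally show ?thesis by linarith
    qed
    have Ckl: "C * (k / l) \<le> l ^ 2"
      using lC l by (simp add: field_simps power2_eq_square power3_eq_cube)
    have "C * (real l / 5) \<le> l ^ 2"
      using mult_left_mono[OF kl5, of C] Ckl C by linarith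
    then have lC5: "C \<le> 5 * l" using l by (simp add: power2_eq_square)
    have l5: "l \<ge> 5" using lC5 C by linarith
    have kl1: "k / l \<ge> 1" using kl5 l5 by linarith
    have c0kl: "1 \<le> c0 * (k / l) / 20"
    proof -
      have "100 / c0 \<le> l" using C(2) lC5 by linarith
      then have "100 \<le> c0 * l" using c0 by (simp add: field_simps)
      also have "c0 * l \<le> c0 * (k / l) * 5" using mult_left_mono[OF kl5, of c0] c0 by simp
      finally have "100 / 5 \<le> c0 * (k / l)" by (subst pos_divide_le_eq) auto
      then show ?thesis by (subst pos_le_divide_eq) auto
    qed
    \<comment> \<open>Rounding down is harmless: elements above \<open>n\<close> are at least
      \<open>n + 1 > K * (k / l)\<close>, so a set of sum \<open>k\<close> has at most
      \<open>l / K\<close> of them.\<close>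
    define n where "n = K * k div l"
    have "real K * (k / l) \<ge> 1 * 1" using K kl1 by (intro mult_mono) auto
    then have "K * k \<ge> l" using l by (simp add: field_simps flip: of_nat_mult)
    then have n1: "n \<ge> 1" using l by (simp add: n_def div_greater_zero_iff Suc_le_eq)
    have n: "n \<le> K * (k / l)" 
    proof -
      have "n * l \<le> K * k" unfolding n_def by simp
      then have "real (n * l) \<le> real (K * k)" by (simp only: of_nat_le_iff)
      then show ?thesis using l by (simp add: field_simps)
    qed
    have n': "K * (k / l) < n + 1"
    proof -
      have "K * k < (n + 1) * l" unfolding n_def using l dividend_less_div_times[of l "K * k"] by simp
      then have "real (K * k) < real ((n + 1) * l)" by (simp only: of_nat_less_iff)
      then show ?thesis using l by (simp add: field_simps)
    qed
    obtain \<C> where \<C>: "\<And>F. finite F \<Longrightarrow> finite (\<C> F) \<and> card (\<C> F) \<le> D ^ card F"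
      and fp: "\<And>S. S \<subseteq> {1..n} \<Longrightarrow> \<exists>F \<subseteq> S. card F \<le> D * sqrt n \<and>
          (\<exists>A\<in>\<C> F. finite A \<and> S - F \<subseteq> A \<and> card A \<le> card (sumset S S) / 2 + \<epsilon> * n + 1)"
      using cont[OF n1] by metis
    \<comment> \<open>\<open>a\<close> bounds the containers; a set \<open>R\<close> gets weight \<open>z ^ card R\<close> with the \<open>z\<close> that is optimal for
      counting \<open>l\<close>-subsets of an \<open>a\<close>-set.\<close>
    define a where "a = 3 / 5 * (c * (k / l))"
    define z where "z = l / a"
    \<comment> \<open>A bound for \<open>z\<close> that does not involve \<open>c\<close>, from
      \<open>5 / 3 \<le> 2\<close> and \<open>c0 \<le> c\<close>.\<close>
    define w where "w = 2 * l ^ 2 / (c0 * k)"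
    have a: "a > 0" using cpos k l by (simp add: a_def)
    have z: "z > 0" using a l by (simp add: z_def)
    have zw: "z \<le> w"
    proof -
      have "z = 5 / 3 * l ^ 2 / (c * k)" using k l cpos by (simp add: z_def a_def field_simps power2_eq_square)
      also have "\<dots> \<le> w" unfolding w_def using c c0 k by (intro frac_le mult_right_mono mult_pos_pos) auto
      finally show ?thesis .
    qed
    define \<L> where "\<L> = {L. finite L \<and> L \<subseteq> {1..} \<and> \<Sum>L \<le> k \<and> real (card L) \<le> l / K}"
    define \<F> where "\<F> = {F. F \<subseteq> {1..n} \<and> card F \<le> D * sqrt n}"
    \<comment> \<open>A fingerprint may also have containers belonging to sets with large sumset;
      these are discarded.\<close>
    define \<C>' where "\<C>' = (\<lambda>F. {A \<in> \<C> F. finite A \<and> card A \<le> a})"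
    have fin: "finite \<S>" "finite \<L>" "finite \<F>"
    proof -
      have "\<S> \<subseteq> {X::nat set. finite X \<and> X \<subseteq> {1..} \<and> \<Sum>X \<le> k}"
        using l by (auto simp: \<S> intro: card_ge_0_finite)
      then show "finite \<S>" using finite_sets_of_bounded_sum finite_subset by blast
      show "finite \<L>"
        unfolding \<L>_def by (rule finite_subset[OF _ finite_sets_of_bounded_sum[of k]]) auto
      show "finite \<F>" unfolding \<F>_def by (rule finite_subset[of _ "Pow {1..n}"]) auto
    qed
    have fF: "finite F" if "F \<in> \<F>" for F using that finite_subset by (auto simp: \<F>_def)
    have count: "card \<S> * z ^ l \<le> (\<Sum>L\<in>\<L>. z ^ card L) * (\<Sum>F\<in>\<F>. (D * z) ^ card F) * exp (z * a)"
    proof (rule card_mult_weight_le[where \<C> = \<C>'])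
      fix F assume "F \<in> \<F>"
      note \<C> = \<C>[OF fF[OF this]]
      then have "card (\<C>' F) \<le> card (\<C> F)" by (intro card_mono) (auto simp: \<C>'_def)
      then have "real (card (\<C>' F)) \<le> D ^ card F" using \<C> by linarith
      then show "finite (\<C>' F) \<and> card (\<C>' F) \<le> D ^ card F" using \<C> by (simp add: \<C>'_def)
    next
      fix S assume "S \<in> \<S>"
      then have S: "S \<subseteq> {1..}" "card S = l" "\<Sum>S = k" "real (card (sumset S S)) \<le> c * real k / real l"
        by (auto simp: \<S>)
      have fS: "finite S" using S(2) l card_ge_0_finite by force
      define L where "L = S \<inter> {n<..}"
      define S0 where "S0 = S \<inter> {1..n}"
      have S_split: "S = L \<union> S0" "L \<inter> S0 = {}" using S(1) by (auto simp: L_def S0_def)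
      obtain F A where FA: "F \<subseteq> S0" "card F \<le> D * sqrt n" "A \<in> \<C> F" "finite A" "S0 - F \<subseteq> A"
        "card A \<le> card (sumset S0 S0) / 2 + \<epsilon> * n + 1"
        using fp[of S0] by (auto simp: S0_def)
      define R where "R = S0 - F"
      have sumL: "\<Sum>L \<le> k"
        unfolding S(3)[symmetric] using fS by (intro sum_mono2) (auto simp: L_def)
      have "card L * (n + 1) \<le> \<Sum>L"
        using sum_mono[of L "\<lambda>_. n + 1" "\<lambda>x. x"] by (auto simp: L_def)
      then have "card L * (n + 1) \<le> k" using sumL by linarith
      then have "real (card L * (n + 1)) \<le> k" by (simp only: of_nat_le_iff)
      then have "real (card L) * (n + 1) \<le> k" by (simp only: of_nat_mult)
      moreover have "real (card L) * (K * (k / l)) \<le> real (card L) * (n + 1)"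
        using n' by (intro mult_left_mono) auto
      ultimately have "real (card L) * (K * (k / l)) \<le> k" by linarith
      then have "card L \<le> l / K" using k l K by (simp add: field_simps)
      then have "L \<in> \<L>" using sumL fS S(1) by (auto simp: \<L>_def L_def)
      moreover have "F \<in> \<F>" using FA by (auto simp: \<F>_def S0_def)
      moreover have "A \<in> \<C>' F"
      proof -
        have "card (sumset S0 S0) \<le> card (sumset S S)"
          using fS by (intro card_mono sumset_mono) (auto simp: S0_def)
        then have "card (sumset S0 S0) \<le> c * (k / l)" using S(4) by simp
        moreover have "\<epsilon> * n \<le> c0 / (20 * K) * (K * (k / l))"
          using \<epsilon> n c0 by (intro mult_mono) auto
        moreover have "c0 / (20 * K) * (K * (k / l)) = c0 * (k / l) / 20" using K by simp
        moreover have "c0 * (k / l) \<le> c * (k / l)" using c by (intro mult_right_mono) auto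
        moreover define q where "q = real k / real l"
        \<comment> \<open>Half the sumset bound plus a twentieth each for
          \<open>\<epsilon> * n\<close> and for the additive 1 gives
          \<open>1/2 + 1/20 + 1/20 = 3/5\<close>.\<close>
        ultimately have "card A \<le> a"
          using FA(6) c0kl unfolding a_def q_def[symmetric] by linarith
        then show ?thesis using FA by (simp add: \<C>'_def)
      qed
      moreover have "R \<in> Pow A" using FA by (auto simp: R_def)
      moreover have "L \<union> F \<union> R = S" using FA S_split by (auto simp: R_def)
      moreover have "l = card L + card F + card R"
      proof -
        have "finite L" "finite S0" using fS by (auto simp: L_def S0_def)
        moreover have "card S = card L + card S0"
          using S_split calculation by (metis card_Un_disjoint)
        moreover have "card S0 = card F + card R"
          using FA(1) calculation by (simp add: R_def card_Diff_subset finite_subset card_mono)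
        ultimately show ?thesis using S(2) by simp
      qed
      ultimately show "\<exists>L\<in>\<L>. \<exists>F\<in>\<F>. \<exists>A\<in>\<C>' F. \<exists>R\<in>Pow A.
        L \<union> F \<union> R = S \<and> l = card L + card F + card R"
        by (intro bexI[of _ L] bexI[of _ F] bexI[of _ A] bexI[of _ R] conjI)
    qed (use z fin in \<open>auto simp: \<C>'_def\<close>)
    have w: "w > 0" using z zw by linarith
    have L: "(\<Sum>L\<in>\<L>. z ^ card L) \<le> exp (3 * l / 100)"
    proof -
      \<comment> \<open>Then \<open>s * k = l / 100\<close>, and \<open>M\<close> was chosen so that
        \<open>w / M / s \<le> l / 100\<close> as well.\<close>
      define s where "s = l / (100 * k)"
      have s: "s > 0" using k l by (simp add: s_def)
      have "(\<Sum>L\<in>\<L>. z ^ card L) \<le> (\<Sum>L\<in>\<L>. w ^ card L)"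
        using z zw by (intro sum_mono power_mono) auto
      also have "\<dots> \<le> M powr (l / K) * (\<Sum>L\<in>\<L>. (w / M) ^ card L)"
        using w M by (intro sum_weight_few) (auto simp: \<L>_def)
      also have "\<dots> \<le> exp (l / 100) * exp (s * k + w / M / s)"
      proof (intro mult_mono)
        have "l / K * ln M \<le> l / 100"
        proof -
          have "l * (100 * ln M) \<le> l * real K" using K by (intro mult_left_mono) auto
          then show ?thesis using K by (simp add: field_simps)
        qed
        then show "M powr (l / K) \<le> exp (l / 100)" using M by (simp add: powr_def)
        show "(\<Sum>L\<in>\<L>. (w / M) ^ card L) \<le> exp (s * k + w / M / s)"
          using w M s by (intro sum_weight_bounded_sum) (auto simp: \<L>_def)
      qed (use w M in \<open>auto intro!: sum_nonneg\<close>)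
      also have "\<dots> \<le> exp (3 * l / 100)"
      proof -
        have "s * k = l / 100" using k by (simp add: s_def)
        moreover have "w / M / s \<le> l / 100"
        proof -
          have "w / M / s = 200 * l / (c0 * M)"
            using k l M c0 by (simp add: w_def s_def field_simps power2_eq_square)
          moreover have "20000 \<le> c0 * M" using M c0 by (simp add: field_simps)
          then have "200 * l / (c0 * M) \<le> 200 * l / 20000" by (intro divide_left_mono) auto
          ultimately show ?thesis by simp
        qed
        ultimately show ?thesis by (simp flip: exp_add)
      qed
      finally show ?thesis .
    qed
    have F: "(\<Sum>F\<in>\<F>. (D * z) ^ card F) \<le> exp (2 * l / 100)"
    proof -
      have "(\<Sum>F\<in>\<F>. (D * z) ^ card F) \<le> M' powr (D * sqrt n) * (\<Sum>F\<in>\<F>. (D * z / M') ^ card F)"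
        using z D M' by (intro sum_weight_few) (auto simp: \<F>_def)
      also have "\<dots> \<le> exp (l / 100) * exp (l / 100)"
      proof (intro mult_mono)
        have "K * (100 * D * ln M') ^ 2 * (k / l) \<le> C * (k / l)"
          using C by (intro mult_right_mono) auto
        then have "K * (k / l) * (100 * D * ln M') ^ 2 \<le> l ^ 2" using Ckl by (simp add: mult_ac)
        moreover have "n * (100 * D * ln M') ^ 2 \<le> K * (k / l) * (100 * D * ln M') ^ 2"
          using n by (intro mult_right_mono) auto
        ultimately have "(sqrt n * (100 * D * ln M')) ^ 2 \<le> real l ^ 2"
          by (simp add: power_mult_distrib)
        then have "sqrt n * (100 * D * ln M') \<le> l" by (rule power2_le_imp_le) simp
        then show "M' powr (D * sqrt n) \<le> exp (l / 100)"
          using M' by (simp add: powr_def mult_ac)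
        have "(\<Sum>F\<in>\<F>. (D * z / M') ^ card F) \<le> (\<Sum>F\<in>Pow {1..n}. (D * z / M') ^ card F)"
          using z D M' by (intro sum_mono2) (auto simp: \<F>_def)
        also have "\<dots> \<le> exp (n * (D * z / M'))"
          using sum_prod_Pow_le_exp[of "{1..n}" "\<lambda>_. D * z / M'"] z D M' by simp
        also have "\<dots> \<le> exp (l / 100)"
        proof -
          have "n * (D * z / M') \<le> K * (k / l) * (D * w / M')"
            using n z D M' zw by (intro mult_mono divide_right_mono) auto
          also have "\<dots> = 2 * K * D / c0 * l / M'"
            using k l c0 M' by (simp add: w_def field_simps power2_eq_square)
          also have "\<dots> \<le> l / 100"
          proof -
            have "200 * K * D / c0 * l \<le> M' * l" using M' by (intro mult_right_mono) auto
            then show ?thesis using M'(1) by (subst pos_divide_le_eq) (auto simp: algebra_simps)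
          qed
          finally show ?thesis by simp
        qed
        finally show "(\<Sum>F\<in>\<F>. (D * z / M') ^ card F) \<le> exp (l / 100)" .
      qed (use z D M' in \<open>auto intro!: sum_nonneg\<close>)
      finally show ?thesis by (simp flip: exp_add)
    qed
    have "card \<S> * z ^ l \<le> exp (3 * l / 100) * exp (2 * l / 100) * exp (z * a)"
      using count L F z D
      by (elim order_trans) (intro mult_mono, auto intro!: sum_nonneg mult_nonneg_nonneg)
    also have "\<dots> \<le> exp (l * (11 / 10))"
      using a by (simp add: z_def flip: exp_add)
    also have "\<dots> = (exp (1 / 10) * exp 1) ^ l"
      by (simp only: exp_of_nat_mult exp_add[symmetric]) simp
    \<comment> \<open>The factor \<open>10 / 9\<close> turns the \<open>3 / 5\<close> in
      \<open>a\<close> into exactly \<open>2 / 3\<close>.\<close>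
    also have "\<dots> \<le> (10 / 9 * exp 1) ^ l"
    proof (intro power_mono mult_right_mono)
      have "9 / 10 \<le> exp (- (1 / 10 :: real))" using exp_ge_add_one_self[of "- (1 / 10)"] by simp
      then show "exp (1 / 10 :: real) \<le> 10 / 9" by (simp add: exp_minus field_simps)
    qed auto
    finally have "card \<S> \<le> (10 / 9 * exp 1) ^ l / z ^ l"
      using z by (simp add: field_simps)
    also have "\<dots> = (2 * c * exp 1 * real k / (3 * real l ^ 2)) ^ l"
      unfolding z_def a_def power_divide[symmetric]
      using l k cpos by (simp add: field_simps power2_eq_square)
    finally show ?thesis .
  qed
  moreover have "C > 0" using C by simp
  ultimately show thesis using that by blast
qed

theorem theorem1p3:
  fixes c0 \<delta> :: real
  assumes "c0 > 0" and "\<delta> > 0"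
  shows "\<exists>C::real. C > 0 \<and>
    (\<forall>k l :: nat. \<forall>c :: real.
       k \<ge> 1 \<longrightarrow> l \<ge> 1 \<longrightarrow> real l ^ 3 \<ge> C * real k \<longrightarrow> c \<ge> c0 \<longrightarrow>
       real (card {S :: nat set. S \<subseteq> {1..} \<and> card S = l \<and> \<Sum>S = k \<and>
                     real (card (sumset S S)) \<le> c * real k / real l})
         \<le> 2 powr (\<delta> * real l) * (2 * c * exp 1 * real k / (3 * real l ^ 2)) ^ l)"
proof -
  obtain C :: real where C: "C > 0"
    "\<And>k l c \<S>. k \<ge> 1 \<Longrightarrow> l \<ge> 1 \<Longrightarrow> real l ^ 3 \<ge> C * real k \<Longrightarrow> c0 \<le> c \<Longrightarrow> c \<le> 5 \<Longrightarrow>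
       \<S> = {S :: nat set. S \<subseteq> {1..} \<and> card S = l \<and> \<Sum>S = k \<and>
                 real (card (sumset S S)) \<le> c * real k / real l} \<Longrightarrow>
       card \<S> \<le> (2 * c * exp 1 * real k / (3 * real l ^ 2)) ^ l"
    using count_small_sumset[OF assms(1)] by blast
  show ?thesis
  proof (intro exI[of _ C] conjI allI impI)
    fix k l :: nat and c :: real
    assume kl: "k \<ge> 1" "l \<ge> 1" "real l ^ 3 \<ge> C * real k" and c: "c \<ge> c0"
    define \<S> where "\<S> = {S :: nat set. S \<subseteq> {1..} \<and> card S = l \<and> \<Sum>S = k \<and>
                     real (card (sumset S S)) \<le> c * real k / real l}"
    let ?b = "2 * c * exp 1 * real k / (3 * real l ^ 2)"
    have "card \<S> \<le> ?b ^ l"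
    proof (cases "c \<le> 5")
      case True
      then show ?thesis using C(2)[OF kl c True \<S>_def] by simp
    next
      case False
      have "card \<S> \<le> (exp 2 * k / l ^ 2) ^ l"
        using kl by (intro card_sets_of_sum_le) (auto simp: \<S>_def)
      also have "\<dots> \<le> ?b ^ l"
      proof (intro power_mono)
        \<comment> \<open>For \<open>c > 5\<close> the factor \<open>2 * c / 3\<close> exceeds 3,
          hence also \<open>exp 1\<close>.\<close>
        have "exp 2 = exp 1 * exp (1::real)" by (simp flip: exp_add)
        also have "\<dots> \<le> 2 * c / 3 * exp 1"
          using exp_le False by (intro mult_right_mono) auto
        finally have "exp 2 * (k / l ^ 2) \<le> 2 * c / 3 * exp 1 * (k / l ^ 2)"
          by (intro mult_right_mono) auto
        then show "exp 2 * k / l ^ 2 \<le> ?b" by (simp add: field_simps)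
      qed auto
      finally show ?thesis .
    qed
    also have "?b ^ l \<le> 2 powr (\<delta> * real l) * ?b ^ l"
      using assms c mult_right_mono[of 1 "2 powr (\<delta> * real l)" "?b ^ l"]
      by (simp add: ge_one_powr_ge_zero)
    finally show "real (card {S :: nat set. S \<subseteq> {1..} \<and> card S = l \<and> \<Sum>S = k \<and>
                     real (card (sumset S S)) \<le> c * real k / real l})
         \<le> 2 powr (\<delta> * real l) * ?b ^ l" by (simp add: \<S>_def)
  qed (use C in auto)
qed

end
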